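(* Let $n\ge 3$ and let \[ B_n=\{X\in\mathbb R^{n\times n}: X\ge 0,\ X\mathbf 1=\mathbf 1,\ X^T\mathbf 1=\mathbf 1\} \] be the Birkhoff polytope, where $\mathbb R^{n\times n}$ is endowed with the Frobenius norm. Then \[ \Phi(B_n)=\frac{1}{\sqrt{\lfloor n^2/4\rfloor}}. \]
   Context: Here $X\ge 0$ is meant entrywise and $\mathbf 1\in\mathbb R^n$ is the all-ones vector. For a polytope $P$ in a Euclidean space with norm $\|\cdot\|$, $\operatorname{vert}(P)$ denotes its set of vertices, $\mathcal F$ denotes the set of its proper faces (all faces other than $\emptyset$ and $P$), and for nonempty compact sets $A,B$, $\operatorname{dist}(A,B)=\min\{\|x-y\|:x\in A,\ y\in B\}$. The facial distance of $P$ is \[ \Phi(P)=\min_{F\in\mathcal F}\operatorname{dist}\bigl(F,\operatorname{conv}(\operatorname{vert}(P)\setminus F)\bigr). \] For $P=B_n$ the norm is the Frobenius norm $\|X\|_F=\bigl(\sum_{i,j}X_{ij}^2\bigr)^{1/2}$. *)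

theory Defs
  imports "HOL-Analysis.Analysis"
begin

definition vertices :: "'a::real_vector set \<Rightarrow> 'a set"
  where "vertices P = {v. v extreme_point_of P}"

definition proper_faces :: "'a::real_vector set \<Rightarrow> 'a set set"
  where "proper_faces P = {F. F face_of P \<and> F \<noteq> {} \<and> F \<noteq> P}"

(* Meant for a polytope P with at least two points. There are then finitely many
   faces, at least one of them proper, and both arguments of setdist are nonempty
   and compact, so that the infimum in setdist is attained. The lemmas below
   record this: no default value of Min or setdist is involved. *)
definition facial_distance :: "'a::real_normed_vector set \<Rightarrow> real"
  where "facial_distance P =
    Min ((\<lambda>F. setdist F (convex hull (vertices P - F))) ` proper_faces P)"

definition birkhoff_polytope :: "(real ^ 'n ^ 'n) set"
  where "birkhoff_polytope =
    {X. (\<forall>i j. 0 \<le> X $ i $ j) \<and> X *v vec 1 = vec 1 \<and> transpose X *v vec 1 = vec 1}"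

lemma finite_proper_faces:
  fixes P :: "'a::euclidean_space set"
  assumes "polytope P"
  shows "finite (proper_faces P)"
  by (rule finite_subset[OF _ finite_polytope_faces[OF assms]]) (auto simp: proper_faces_def)

lemma proper_faces_nonempty:
  fixes P :: "'a::euclidean_space set"
  assumes P: "polytope P" and "x \<in> P" "y \<in> P" "x \<noteq> y"
  shows "proper_faces P \<noteq> {}"
proof -
  have "P = convex hull {v. v extreme_point_of P}"
    by (rule Krein_Milman_Minkowski[OF polytope_imp_compact[OF P] polytope_imp_convex[OF P]])
  with \<open>x \<in> P\<close> obtain v where "v extreme_point_of P"
    by (cases "{v. v extreme_point_of P} = {}") auto
  then have "{v} \<in> proper_faces P"
    using assms by (auto simp: proper_faces_def face_of_singleton)
  then show ?thesis by blast
qed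

lemma proper_face_setdist_attained:
  fixes P :: "'a::euclidean_space set"
  assumes P: "polytope P" and F: "F \<in> proper_faces P"
  defines "C \<equiv> convex hull (vertices P - F)"
  shows "F \<noteq> {}" "compact F" "C \<noteq> {}" "compact C"
    and "\<exists>x\<in>F. \<exists>y\<in>C. norm (x - y) = setdist F C \<and>
          (\<forall>x'\<in>F. \<forall>y'\<in>C. norm (x - y) \<le> norm (x' - y'))"
proof -
  have face: "F face_of P" "F \<noteq> {}" "F \<noteq> P"
    using F by (auto simp: proper_faces_def)
  show ne: "F \<noteq> {}" by fact
  show cF: "compact F"
    using face_of_polytope_polytope[OF P face(1)] polytope_imp_compact by blast
  have fin: "finite (vertices P)"
    unfolding vertices_def using P finite_polyhedron_extreme_points polytope_imp_polyhedron by blast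
  then show cC: "compact C"
    unfolding C_def by (intro finite_imp_compact_convex_hull) auto
  have "\<not> vertices P \<subseteq> F"
  proof
    assume sub: "vertices P \<subseteq> F"
    have "P = convex hull (vertices P)"
      unfolding vertices_def
      by (rule Krein_Milman_Minkowski[OF polytope_imp_compact[OF P] polytope_imp_convex[OF P]])
    also have "\<dots> \<subseteq> F"
      using sub face_of_imp_convex[OF face(1)] by (rule hull_minimal)
    finally show False
      using face face_of_imp_subset by blast
  qed
  then show neC: "C \<noteq> {}" unfolding C_def by auto
  obtain x y where "x \<in> F" "y \<in> C" "dist x y = setdist F C"
    using setdist_compact_closed[OF cF compact_imp_closed[OF cC] ne neC] by metis
  then show "\<exists>x\<in>F. \<exists>y\<in>C. norm (x - y) = setdist F C \<and>
          (\<forall>x'\<in>F. \<forall>y'\<in>C. norm (x - y) \<le> norm (x' - y'))"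
    by (metis dist_norm setdist_le_dist)
qed

(* The library norm on nested vectors is the Frobenius norm. *)
lemma norm_matrix_eq_Frobenius:
  fixes X :: "real ^ 'n ^ 'm"
  shows "norm X = sqrt (\<Sum>i\<in>UNIV. \<Sum>j\<in>UNIV. (X $ i $ j)\<^sup>2)"
  by (simp add: norm_vec_def L2_set_def sum_nonneg)

lemma polytope_birkhoff_polytope: "polytope (birkhoff_polytope :: (real ^ 'n ^ 'n) set)"
proof -
  have row: "(X *v vec 1) $ i = (\<Sum>j\<in>UNIV. X $ i $ j)" for X :: "real ^ 'n ^ 'n" and i
    by (simp add: matrix_vector_mult_def)
  define N where "N = (\<lambda>(i::'n, j::'n). {X :: real ^ 'n ^ 'n. axis i (axis j 1) \<bullet> X \<ge> 0})"
  define R where "R = (\<lambda>i::'n. {X :: real ^ 'n ^ 'n. axis i (vec 1) \<bullet> X = 1})"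
  define K where "K = (\<lambda>j::'n. {X :: real ^ 'n ^ 'n. (\<chi> i. axis j 1) \<bullet> X = 1})"
  have eq: "birkhoff_polytope = \<Inter> (range N \<union> range R \<union> range K)"
  proof -
    have N: "N p = {X. 0 \<le> X $ fst p $ snd p}" for p
      by (cases p) (simp add: N_def inner_axis')
    have R: "R i = {X. (\<Sum>j\<in>UNIV. X $ i $ j) = 1}" for i
      unfolding R_def inner_axis' by (simp add: inner_vec_def)
    have K: "K j = {X. (\<Sum>i\<in>UNIV. X $ i $ j) = 1}" for j
      unfolding K_def by (simp add: inner_vec_def[of "\<chi> i. axis j 1"] inner_axis')
    have "birkhoff_polytope = {X :: real ^ 'n ^ 'n. (\<forall>i j. 0 \<le> X $ i $ j) \<and>
        (\<forall>i. (\<Sum>j\<in>UNIV. X $ i $ j) = 1) \<and> (\<forall>j. (\<Sum>i\<in>UNIV. X $ i $ j) = 1)}"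
      unfolding birkhoff_polytope_def vec_eq_iff[of "_ *v _"] row by (simp add: transpose_def)
    also have "\<dots> = \<Inter> (range N \<union> range R \<union> range K)"
      unfolding N R K Inter_Un_distrib by auto
    finally show ?thesis .
  qed
  have "polyhedron (birkhoff_polytope :: (real ^ 'n ^ 'n) set)"
    unfolding eq
    by (rule polyhedron_Inter)
      (auto simp: N_def R_def K_def polyhedron_halfspace_ge polyhedron_hyperplane)
  moreover have "bounded (birkhoff_polytope :: (real ^ 'n ^ 'n) set)"
  proof (rule boundedI)
    fix X :: "real ^ 'n ^ 'n" assume X: "X \<in> birkhoff_polytope"
    have "norm X \<le> (\<Sum>i\<in>UNIV. norm (X $ i))"
      by (simp add: norm_vec_def L2_set_le_sum)
    also have "\<dots> \<le> (\<Sum>i\<in>UNIV. \<Sum>j\<in>UNIV. \<bar>X $ i $ j\<bar>)"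
      by (intro sum_mono norm_le_l1_cart)
    also have "\<dots> = (\<Sum>i\<in>(UNIV::'n set). 1)"
      using X unfolding birkhoff_polytope_def vec_eq_iff[of "_ *v _"] row
      by (intro sum.cong) auto
    finally show "norm X \<le> real CARD('n)" by simp
  qed
  ultimately show ?thesis
    by (simp add: polytope_eq_bounded_polyhedron)
qed

end

theory Submission
  imports Defs
begin

text \<open>Let \<open>Z\<close> be the set of positions at which all of \<open>F\<close> vanishes, and \<open>r i\<close> the number of them in
  row \<open>i\<close>. Vertices of the Birkhoff polytope have entries 0 and 1, and a vertex outside \<open>F\<close> has a 1
  in \<open>Z\<close>. So if \<open>X\<close> lies in \<open>F\<close> and \<open>Y\<close> in the hull of the other vertices, the entries of \<open>Y - X\<close>
  over \<open>Z\<close> add up to at least 1. The rows of \<open>Y - X\<close> add up to 0, so one may subtract \<open>r i / n\<close> from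
  row \<open>i\<close> of the indicator matrix of \<open>Z\<close>, after which its squared norm is the average of the
  integers \<open>r i * (n - r i)\<close>, each at most the floor of \<open>n\<^sup>2 / 4\<close>. The lower bound is then
  Cauchy-Schwarz.

  For equality, index rows and columns by the integers modulo \<open>n\<close>, let \<open>k = n div 2\<close> and let \<open>Z\<close> be
  the positions \<open>(i, j)\<close> with \<open>j - i \<in> {1..k}\<close>. For each \<open>(s, s + d)\<close> in \<open>Z\<close>, the cycle
  \<open>s \<mapsto> s + d \<mapsto> s + d - 1 \<mapsto> \<dots> \<mapsto> s\<close> meets \<open>Z\<close> only there, because its other displacements are 0 and
  -1, and -1 is not in \<open>{1..k}\<close> modulo \<open>n\<close> when \<open>n \<ge> 3\<close>. The average \<open>Y\<close> of these permutation
  matrices is constant on \<open>Z\<close>, and subtracting the suitable multiple of the centred indicator of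
  \<open>Z\<close> leads to a point of the face of matrices vanishing on \<open>Z\<close>.\<close>

section \<open>Coordinates of the Birkhoff polytope and its zero-one points\<close>

lemma birkhoff_polytope_iff:
  fixes X :: "real ^ 'n ^ 'n"
  shows "X \<in> birkhoff_polytope \<longleftrightarrow> (\<forall>i j. 0 \<le> X $ i $ j) \<and>
    (\<forall>i. (\<Sum>j\<in>UNIV. X $ i $ j) = 1) \<and> (\<forall>j. (\<Sum>i\<in>UNIV. X $ i $ j) = 1)"
  by (simp add: birkhoff_polytope_def vec_eq_iff matrix_vector_mult_def transpose_def)

lemma birkhoff_polytope_le_1:
  fixes X :: "real ^ 'n ^ 'n"
  assumes "X \<in> birkhoff_polytope"
  shows "X $ i $ j \<le> 1"
proof -
  have "X $ i $ j \<le> (\<Sum>j\<in>UNIV. X $ i $ j)"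
    using assms by (intro member_le_sum) (auto simp: birkhoff_polytope_iff)
  then show ?thesis using assms by (simp add: birkhoff_polytope_iff)
qed

lemma convex_birkhoff_polytope: "convex (birkhoff_polytope :: (real ^ 'n ^ 'n) set)"
  by (rule polytope_imp_convex[OF polytope_birkhoff_polytope])

text \<open>Entries range over the unit interval, whose ends are extreme, so both ends of an open
  segment through \<open>V\<close> would agree with \<open>V\<close> in every entry.\<close>

lemma vertex_if_zero_one:
  fixes V :: "real ^ 'n ^ 'n"
  assumes V: "V \<in> birkhoff_polytope" and zo: "\<And>i j. V $ i $ j \<in> {0, 1}"
  shows "V \<in> vertices birkhoff_polytope"
  unfolding vertices_def extreme_point_of_def mem_Collect_eq
proof (intro conjI ballI notI)
  fix A B :: "real ^ 'n ^ 'n"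
  assume A: "A \<in> birkhoff_polytope" and B: "B \<in> birkhoff_polytope" and "V \<in> open_segment A B"
  then obtain u where u: "A \<noteq> B" "0 < u" "u < 1" "V = (1 - u) *\<^sub>R A + u *\<^sub>R B"
    by (auto simp: in_segment)
  have "A $ i $ j = B $ i $ j" for i j
  proof -
    have a: "0 \<le> A $ i $ j" "A $ i $ j \<le> 1" "0 \<le> B $ i $ j" "B $ i $ j \<le> 1"
      using A B birkhoff_polytope_le_1 by (auto simp: birkhoff_polytope_iff)
    have eq: "V $ i $ j = (1 - u) * A $ i $ j + u * B $ i $ j"
      by (simp add: u(4))
    consider "V $ i $ j = 0" | "V $ i $ j = 1" using zo[of i j] by auto
    then show ?thesis
    proof cases
      case 1
      then show ?thesis using eq a u
        by (simp add: add_nonneg_eq_0_iff)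
    next
      case 2
      then have "(1 - u) * (1 - A $ i $ j) + u * (1 - B $ i $ j) = 0"
        using eq by (simp add: algebra_simps)
      then show ?thesis using a u
        by (simp add: add_nonneg_eq_0_iff)
    qed
  qed
  then show False using u(1) by (simp add: vec_eq_iff)
qed (fact V)

section \<open>Integrality of the vertices\<close>

text \<open>Supplies the step size for perturbing a matrix without making an entry negative. The
  added 1 keeps the finite set of ratios nonempty when \<open>b\<close> is zero.\<close>

lemma ex_scale_le:
  fixes a b :: "'p::finite \<Rightarrow> real"
  assumes "\<And>p. 0 \<le> a p" and "\<And>p. b p \<noteq> 0 \<Longrightarrow> 0 < a p"
  shows "\<exists>\<epsilon>>0. \<forall>p. \<epsilon> * \<bar>b p\<bar> \<le> a p"
proof -
  define E where "E = insert 1 ((\<lambda>p. a p / \<bar>b p\<bar>) ` {p. b p \<noteq> 0})"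
  have "finite E" "E \<noteq> {}" "\<forall>e\<in>E. 0 < e"
    using assms by (auto simp: E_def)
  then have "0 < Min E" by simp
  moreover have "Min E * \<bar>b p\<bar> \<le> a p" for p
  proof (cases "b p = 0")
    case False
    then have "Min E \<le> a p / \<bar>b p\<bar>" using \<open>finite E\<close> by (auto simp: E_def)
    then show ?thesis using False by (simp add: field_simps)
  qed (use assms in simp)
  ultimately show ?thesis by blast
qed

text \<open>The other values sum to less than 1. If each were 0 or 1, all would be 0, and
  \<open>f j\<close> would have to be 1.\<close>

lemma fractional_entry_has_companion:
  fixes f :: "'a::finite \<Rightarrow> real"
  assumes nn: "\<And>j. 0 \<le> f j" and s: "(\<Sum>j\<in>UNIV. f j) = 1" and j: "f j \<notin> {0, 1}"
  shows "\<exists>j'. j' \<noteq> j \<and> f j' \<notin> {0, 1}"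
proof (rule ccontr)
  assume "\<not> ?thesis"
  then have zo: "f j' \<in> {0, 1}" if "j' \<noteq> j" for j' using that by blast
  have split: "1 = f j + (\<Sum>j'\<in>UNIV - {j}. f j')"
    by (metis s finite UNIV_I sum.remove)
  have "(\<Sum>j'\<in>UNIV - {j}. f j') < 1"
    using split nn[of j] j by auto
  moreover have "f j' \<le> (\<Sum>j'\<in>UNIV - {j}. f j')" if "j' \<noteq> j" for j'
    using that nn by (intro member_le_sum) auto
  ultimately have "f j' = 0" if "j' \<noteq> j" for j'
    using zo[OF that] that by fastforce
  then have "(\<Sum>j'\<in>UNIV - {j}. f j') = 0" by simp
  then show False using split j by simp
qed

text \<open>Every nonempty fibre of the first projection has at least two points.\<close>

lemma two_mult_card_fst_image_le:
  assumes "finite S" and "\<And>i j. (i, j) \<in> S \<Longrightarrow> \<exists>j'. j' \<noteq> j \<and> (i, j') \<in> S"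
  shows "2 * card (fst ` S) \<le> card S"
proof -
  have "S = Sigma (fst ` S) (\<lambda>i. {j. (i, j) \<in> S})" by force
  moreover have fin: "finite {j. (i, j) \<in> S}" for i
    by (rule finite_subset[of _ "snd ` S"]) (use assms(1) in force)+
  ultimately have "card S = (\<Sum>i\<in>fst ` S. card {j. (i, j) \<in> S})"
    using card_SigmaI[of "fst ` S" "\<lambda>i. {j. (i, j) \<in> S}"] assms(1) by simp
  also have "\<dots> \<ge> (\<Sum>i\<in>fst ` S. 2)"
  proof (rule sum_mono)
    fix i assume "i \<in> fst ` S"
    then obtain j j' where "j' \<noteq> j" "{j, j'} \<subseteq> {j. (i, j) \<in> S}"
      using assms(2) by fastforce
    then show "2 \<le> card {j. (i, j) \<in> S}"
      using card_mono[OF fin, of "{j, j'}" i] by simp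
  qed
  finally show ?thesis by (simp add: mult.commute)
qed

text \<open>The vectors \<open>(e\<^sub>i, e\<^sub>j)\<close> with \<open>(i, j) \<in> S\<close> span a space of dimension less than
  \<open>card (fst ` S) + card (snd ` S)\<close>, which is at most \<open>card S\<close>. They are therefore dependent, and a
  linear relation between them is a matrix with vanishing marginals.\<close>

lemma ex_zero_marginals_supported:
  fixes S :: "('n::finite \<times> 'n) set"
  assumes ne: "S \<noteq> {}"
    and row: "\<And>i j. (i, j) \<in> S \<Longrightarrow> \<exists>j'. j' \<noteq> j \<and> (i, j') \<in> S"
    and col: "\<And>i j. (i, j) \<in> S \<Longrightarrow> \<exists>i'. i' \<noteq> i \<and> (i', j) \<in> S"
  shows "\<exists>W :: real ^ 'n ^ 'n. W \<noteq> 0 \<and> (\<forall>i j. (i, j) \<notin> S \<longrightarrow> W $ i $ j = 0) \<and>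
    (\<forall>i. (\<Sum>j\<in>UNIV. W $ i $ j) = 0) \<and> (\<forall>j. (\<Sum>i\<in>UNIV. W $ i $ j) = 0)"
proof -
  define \<phi> where "\<phi> = (\<lambda>p :: 'n \<times> 'n. (axis (fst p) 1 :: real ^ 'n, axis (snd p) 1 :: real ^ 'n))"
  have inj: "inj \<phi>"
    by (auto simp: inj_on_def \<phi>_def axis_eq_axis)
  obtain i0 j0 where ij0: "(i0, j0) \<in> S" using ne by auto
  \<comment> \<open>These span because \<open>(axis i 1, axis j 1)\<close> is the sum of
    \<open>(axis i 1, axis j0 1)\<close> and \<open>(0, axis j 1 - axis j0 1)\<close>. Leaving
    \<open>j0\<close> out of \<open>T2\<close> makes the count strict.\<close>
  define T1 where "T1 = (\<lambda>i. (axis i 1 :: real ^ 'n, axis j0 1 :: real ^ 'n)) ` fst ` S"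
  define T2 where
    "T2 = (\<lambda>j. (0 :: real ^ 'n, axis j 1 - axis j0 1 :: real ^ 'n)) ` (snd ` S - {j0})"
  have "2 * card (fst ` S) \<le> card S"
    by (rule two_mult_card_fst_image_le) (use row in auto)
  moreover have "2 * card (fst ` prod.swap ` S) \<le> card (prod.swap ` S)"
    by (rule two_mult_card_fst_image_le) (use col in force)+
  then have "2 * card (snd ` S) \<le> card S"
    using card_image[OF inj_swap, of S] by (simp add: image_image)
  moreover have "card T1 \<le> card (fst ` S)"
    unfolding T1_def by (rule card_image_le) simp
  moreover have "j0 \<in> snd ` S" using ij0 by force
  then have "card T2 < card (snd ` S)"
    unfolding T2_def by (intro le_less_trans[OF card_image_le card_Diff1_less]) auto
  moreover have "card (T1 \<union> T2) \<le> card T1 + card T2" by (rule card_Un_le)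
  ultimately have "card (T1 \<union> T2) < card S" by linarith
  also have "card S = card (\<phi> ` S)" using inj by (simp add: card_image inj_on_subset)
  finally have less: "card (T1 \<union> T2) < card (\<phi> ` S)" .
  have "\<phi> ` S \<subseteq> span (T1 \<union> T2)"
  proof
    fix v assume "v \<in> \<phi> ` S"
    then obtain i j where ij: "(i, j) \<in> S" "v = \<phi> (i, j)" by auto
    have 1: "(axis i 1, axis j0 1) \<in> span (T1 \<union> T2)"
      by (rule span_base) (use ij in \<open>force simp: T1_def\<close>)
    have 2: "(0, axis j 1 - axis j0 1) \<in> span (T1 \<union> T2)"
    proof (cases "j = j0")
      case True
      then show ?thesis using span_zero[of "T1 \<union> T2"] by (simp add: zero_prod_def)
    next
      case False
      then show ?thesis by (intro span_base) (use ij in \<open>force simp: T2_def\<close>)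
    qed
    show "v \<in> span (T1 \<union> T2)"
      using span_add[OF 1 2] ij by (simp add: \<phi>_def)
  qed
  then have "dependent (\<phi> ` S)"
    using independent_span_bound[of "T1 \<union> T2" "\<phi> ` S"] less by (auto simp: T1_def T2_def)
  then obtain u where u: "\<exists>v\<in>\<phi> ` S. u v \<noteq> 0" "(\<Sum>v\<in>\<phi> ` S. u v *\<^sub>R v) = 0"
    by (subst (asm) dependent_finite) auto
  have u0: "(\<Sum>p\<in>S. u (\<phi> p) *\<^sub>R \<phi> p) = 0"
    using u(2) inj by (simp add: sum.reindex inj_on_subset)
  define W :: "real ^ 'n ^ 'n" where "W = (\<chi> i j. if (i, j) \<in> S then u (\<phi> (i, j)) else 0)"
  \<comment> \<open>Taking \<open>g\<close> to be the indicator of a row or a column turns the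
    linear relation into a marginal of \<open>W\<close>.\<close>
  have W_sum: "(\<Sum>p\<in>S. u (\<phi> p) * g p) = (\<Sum>i\<in>UNIV. \<Sum>j\<in>UNIV. W $ i $ j * g (i, j))" for g
  proof -
    have "(\<Sum>p\<in>S. u (\<phi> p) * g p) = (\<Sum>p\<in>UNIV. (if p \<in> S then u (\<phi> p) else 0) * g p)"
      by (rule sum.mono_neutral_cong_left) auto
    also have "\<dots> = (\<Sum>i\<in>UNIV. \<Sum>j\<in>UNIV. W $ i $ j * g (i, j))"
      unfolding sum.cartesian_product by (auto simp: W_def intro!: sum.cong)
    finally show ?thesis .
  qed
  have "(\<Sum>j\<in>UNIV. W $ a $ j) = 0" for a
  proof -
    have "0 = fst (\<Sum>p\<in>S. u (\<phi> p) *\<^sub>R \<phi> p) $ a" by (simp add: u0)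
    also have "\<dots> = (\<Sum>p\<in>S. u (\<phi> p) * of_bool (fst p = a))"
      unfolding fst_sum sum_component by (rule sum.cong) (auto simp: \<phi>_def axis_def)
    also have "\<dots> = (\<Sum>i\<in>UNIV. of_bool (i = a) * (\<Sum>j\<in>UNIV. W $ i $ j))"
      unfolding W_sum by (simp add: sum_distrib_left mult.commute)
    also have "\<dots> = (\<Sum>j\<in>UNIV. W $ a $ j)"
      by (simp add: of_bool_def if_distrib[of "\<lambda>x. x * _"] cong: if_cong)
    finally show ?thesis by simp
  qed
  moreover have "(\<Sum>i\<in>UNIV. W $ i $ b) = 0" for b
  proof -
    have "0 = snd (\<Sum>p\<in>S. u (\<phi> p) *\<^sub>R \<phi> p) $ b" by (simp add: u0)
    also have "\<dots> = (\<Sum>p\<in>S. u (\<phi> p) * of_bool (snd p = b))"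
      unfolding snd_sum sum_component by (rule sum.cong) (auto simp: \<phi>_def axis_def)
    also have "\<dots> = (\<Sum>i\<in>UNIV. W $ i $ b)"
      unfolding W_sum by (simp add: of_bool_def if_distrib[of "\<lambda>x. _ * x"] cong: if_cong)
    finally show ?thesis by simp
  qed
  moreover have "W \<noteq> 0"
  proof -
    obtain i j where "(i, j) \<in> S" "u (\<phi> (i, j)) \<noteq> 0" using u(1) by auto
    then have "W $ i $ j \<noteq> 0" by (simp add: W_def)
    then show ?thesis by (auto simp: vec_eq_iff)
  qed
  ultimately show ?thesis by (intro exI[of _ W]) (auto simp: W_def)
qed

text \<open>The integrality part of the Birkhoff-von Neumann theorem. The fractional positions would
  support a nonzero \<open>W\<close> with zero marginals; as \<open>V\<close> is positive there,
  \<open>V\<close> would be the midpoint of two points \<open>V - \<epsilon> *\<^sub>R W\<close> and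
  \<open>V + \<epsilon> *\<^sub>R W\<close> of the polytope.\<close>

lemma vertex_zero_one:
  fixes V :: "real ^ 'n ^ 'n"
  assumes "V \<in> vertices birkhoff_polytope"
  shows "V $ i $ j \<in> {0, 1}"
proof (rule ccontr)
  assume frac: "V $ i $ j \<notin> {0, 1}"
  have ext: "V extreme_point_of birkhoff_polytope" using assms by (simp add: vertices_def)
  then have V: "V \<in> birkhoff_polytope" by (simp add: extreme_point_of_def)
  note V' = V[unfolded birkhoff_polytope_iff]
  define S where "S = {(i, j). V $ i $ j \<notin> {0, 1}}"
  have "\<exists>j'. j' \<noteq> b \<and> (a, j') \<in> S" if "(a, b) \<in> S" for a b
    using fractional_entry_has_companion[of "\<lambda>j. V $ a $ j" b] V' that by (auto simp: S_def)
  moreover have "\<exists>i'. i' \<noteq> a \<and> (i', b) \<in> S" if "(a, b) \<in> S" for a b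
    using fractional_entry_has_companion[of "\<lambda>i. V $ i $ b" a] V' that by (auto simp: S_def)
  moreover have "S \<noteq> {}" using frac by (auto simp: S_def)
  ultimately obtain W :: "real ^ 'n ^ 'n" where W: "W \<noteq> 0"
    "\<And>i j. (i, j) \<notin> S \<Longrightarrow> W $ i $ j = 0"
    "\<And>i. (\<Sum>j\<in>UNIV. W $ i $ j) = 0" "\<And>j. (\<Sum>i\<in>UNIV. W $ i $ j) = 0"
    using ex_zero_marginals_supported[of S] by blast
  have "\<exists>\<epsilon>>0. \<forall>p. \<epsilon> * \<bar>W $ fst p $ snd p\<bar> \<le> V $ fst p $ snd p"
  proof (rule ex_scale_le)
    fix p assume "W $ fst p $ snd p \<noteq> 0"
    then have "V $ fst p $ snd p \<noteq> 0" using W(2)[of "fst p" "snd p"] by (cases p) (auto simp: S_def)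
    then show "0 < V $ fst p $ snd p" using V' by (simp add: order_less_le)
  qed (use V' in auto)
  then obtain \<epsilon> where \<epsilon>: "\<epsilon> > 0" "\<And>i j. \<epsilon> * \<bar>W $ i $ j\<bar> \<le> V $ i $ j" by auto
  have in_B: "V + c *\<^sub>R W \<in> birkhoff_polytope" if "\<bar>c\<bar> = \<epsilon>" for c
  proof -
    have "0 \<le> V $ i $ j + c * W $ i $ j" for i j
    proof -
      have "\<bar>c * W $ i $ j\<bar> \<le> V $ i $ j" using \<epsilon>(2)[of i j] that by (simp add: abs_mult)
      then show ?thesis by linarith
    qed
    then show ?thesis using V' W
      by (simp add: birkhoff_polytope_iff sum.distrib flip: sum_distrib_left)
  qed
  have "V - \<epsilon> *\<^sub>R W \<in> birkhoff_polytope" "V + \<epsilon> *\<^sub>R W \<in> birkhoff_polytope"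
    using in_B[of "- \<epsilon>"] in_B[of \<epsilon>] \<epsilon> by auto
  moreover have "V - \<epsilon> *\<^sub>R W \<noteq> V + \<epsilon> *\<^sub>R W"
  proof
    assume "V - \<epsilon> *\<^sub>R W = V + \<epsilon> *\<^sub>R W"
    then have "(2 * \<epsilon>) *\<^sub>R W = 0" by (simp add: algebra_simps flip: scaleR_2)
    then show False using W(1) \<epsilon>(1) by simp
  qed
  then have "midpoint (V - \<epsilon> *\<^sub>R W) (V + \<epsilon> *\<^sub>R W) \<in> open_segment (V - \<epsilon> *\<^sub>R W) (V + \<epsilon> *\<^sub>R W)"
    by simp
  moreover have "midpoint (V - \<epsilon> *\<^sub>R W) (V + \<epsilon> *\<^sub>R W) = V"
    by (simp add: midpoint_def flip: scaleR_2)
  ultimately show False using ext by (auto simp: extreme_point_of_def)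
qed

section \<open>Zero patterns of faces and the lower bound\<close>

text \<open>Otherwise an average \<open>A\<close> of members of \<open>F\<close> is positive
  wherever \<open>V\<close> is, hence lies strictly inside a segment of the polytope starting at
  \<open>V\<close>, and the face property puts \<open>V\<close> into \<open>F\<close>.\<close>

lemma face_of_birkhoff_polytope_separation:
  fixes V :: "real ^ 'n ^ 'n"
  assumes F: "F face_of birkhoff_polytope" "F \<noteq> {}"
    and V: "V \<in> birkhoff_polytope" "V \<notin> F"
  shows "\<exists>i j. V $ i $ j \<noteq> 0 \<and> (\<forall>X\<in>F. X $ i $ j = 0)"
proof (rule ccontr)
  assume "\<not> ?thesis"
  \<comment> \<open>Where \<open>V\<close> vanishes any member of \<open>F\<close> serves, so the
    average can run over all positions.\<close>
  then have "\<forall>p. \<exists>X\<in>F. V $ fst p $ snd p \<noteq> 0 \<longrightarrow> X $ fst p $ snd p \<noteq> 0"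
    using F(2) by blast
  then obtain G where G: "\<And>p. G p \<in> F"
    "\<And>p. V $ fst p $ snd p \<noteq> 0 \<Longrightarrow> G p $ fst p $ snd p \<noteq> 0" by metis
  have FB: "F \<subseteq> birkhoff_polytope" using F(1) by (rule face_of_imp_subset)
  define c where "c = 1 / real CARD('n \<times> 'n)"
  have c: "c > 0" "c * real CARD('n \<times> 'n) = 1" by (simp_all add: c_def)
  define A where "A = (\<Sum>p\<in>UNIV. c *\<^sub>R G p)"
  have AF: "A \<in> F" unfolding A_def
    by (rule convex_sum[OF _ face_of_imp_convex[OF F(1)]]) (use c G in \<open>auto simp: mult.commute\<close>)
  then have A: "A \<in> birkhoff_polytope" using FB by blast
  have "\<exists>\<epsilon>>0. \<forall>p. \<epsilon> * \<bar>V $ fst p $ snd p\<bar> \<le> A $ fst p $ snd p"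
  proof (rule ex_scale_le)
    fix p assume "V $ fst p $ snd p \<noteq> 0"
    have nn: "0 \<le> G q $ i $ j" for q i j using G(1)[of q] FB by (auto simp: birkhoff_polytope_iff)
    then have "0 < c * G p $ fst p $ snd p"
      using G(2)[OF \<open>V $ fst p $ snd p \<noteq> 0\<close>] c by (simp add: order_less_le)
    also have "\<dots> \<le> (\<Sum>q\<in>UNIV. c * G q $ fst p $ snd p)"
      by (rule member_le_sum) (use c nn in auto)
    also have "\<dots> = A $ fst p $ snd p" by (simp add: A_def)
    finally show "0 < A $ fst p $ snd p" .
  qed (use A in \<open>auto simp: birkhoff_polytope_iff\<close>)
  then obtain \<epsilon> where \<epsilon>: "\<epsilon> > 0" "\<And>i j. \<epsilon> * \<bar>V $ i $ j\<bar> \<le> A $ i $ j" by auto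
  \<comment> \<open>The segment from \<open>V\<close> to \<open>A\<close> is prolonged beyond
    \<open>A\<close>; the choice of \<open>\<epsilon>\<close> keeps the entries nonnegative.\<close>
  define W where "W = A + \<epsilon> *\<^sub>R (A - V)"
  have "0 \<le> W $ i $ j" for i j
  proof -
    have "0 \<le> V $ i $ j" "0 \<le> A $ i $ j" using V(1) A by (auto simp: birkhoff_polytope_iff)
    moreover from this have "0 \<le> \<epsilon> * A $ i $ j" using \<epsilon>(1) by simp
    ultimately show ?thesis using \<epsilon>(2)[of i j] by (simp add: W_def algebra_simps)
  qed
  then have WB: "W \<in> birkhoff_polytope"
    using A V(1)
    by (simp add: birkhoff_polytope_iff W_def sum.distrib sum_subtractf flip: sum_distrib_left)
  have "(1 + \<epsilon>) *\<^sub>R A = \<epsilon> *\<^sub>R V + W" by (simp add: W_def algebra_simps)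
  then have "A = (1 / (1 + \<epsilon>)) *\<^sub>R (\<epsilon> *\<^sub>R V + W)"
    using \<epsilon>(1) by (metis add_pos_pos less_irrefl scaleR_scaleR scaleR_one nonzero_eq_divide_eq zero_less_one)
  also have "\<dots> = (1 - 1 / (1 + \<epsilon>)) *\<^sub>R V + (1 / (1 + \<epsilon>)) *\<^sub>R W"
    using \<epsilon>(1) by (simp add: scaleR_add_right field_simps)
  finally have Aeq: "A = (1 - 1 / (1 + \<epsilon>)) *\<^sub>R V + (1 / (1 + \<epsilon>)) *\<^sub>R W" .
  have "V \<noteq> W"
  proof
    assume "V = W"
    then have "A = V" by (subst Aeq) (simp add: flip: scaleR_add_left)
    then show False using AF V(2) by simp
  qed
  then have "A \<in> open_segment V W"
    unfolding in_segment using Aeq \<epsilon>(1) by (intro conjI exI[of _ "1 / (1 + \<epsilon>)"]) auto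
  then have "V \<in> F" using F(1) V(1) WB AF unfolding face_of_def by blast
  then show False using V(2) by simp
qed

text \<open>Stated for pairs of points, to be applied to a pair at which \<open>setdist\<close> is
  attained.\<close>

lemma facial_distance_lower:
  fixes F :: "(real ^ 'n ^ 'n) set"
  assumes F: "F \<in> proper_faces birkhoff_polytope"
    and X: "X \<in> F" and Y: "Y \<in> convex hull (vertices birkhoff_polytope - F)"
  shows "1 / sqrt (real_of_int \<lfloor>(real CARD('n))\<^sup>2 / 4\<rfloor>) \<le> norm (X - Y)"
proof -
  let ?n = "real CARD('n)"
  let ?m = "real_of_int \<lfloor>?n\<^sup>2 / 4\<rfloor>"
  have face: "F face_of birkhoff_polytope" "F \<noteq> {}" using F by (auto simp: proper_faces_def)
  have XB: "X \<in> birkhoff_polytope" using face_of_imp_subset[OF face(1)] X by blast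
  define Z where "Z = (\<lambda>i. {j. \<forall>X\<in>F. X $ i $ j = 0})"
  \<comment> \<open>A half-space, so a bound at the vertices outside \<open>F\<close> passes to
    their hull.\<close>
  define U where "U = {Y :: real ^ 'n ^ 'n. 1 \<le> (\<Sum>i\<in>UNIV. \<Sum>j\<in>Z i. Y $ i $ j)}"
  have "vertices birkhoff_polytope - F \<subseteq> birkhoff_polytope \<inter> U"
  proof
    fix V assume V: "V \<in> vertices birkhoff_polytope - F"
    then have VB: "V \<in> birkhoff_polytope" by (auto simp: vertices_def extreme_point_of_def)
    obtain i j where ij: "V $ i $ j \<noteq> 0" "j \<in> Z i"
      using face_of_birkhoff_polytope_separation[OF face VB] V by (auto simp: Z_def)
    then have "1 = V $ i $ j" using vertex_zero_one[of V i j] V by auto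
    also have "\<dots> \<le> (\<Sum>j\<in>Z i. V $ i $ j)"
      using ij VB by (intro member_le_sum) (auto simp: birkhoff_polytope_iff)
    also have "\<dots> \<le> (\<Sum>i\<in>UNIV. \<Sum>j\<in>Z i. V $ i $ j)"
      using VB by (intro member_le_sum[where f = "\<lambda>i. \<Sum>j\<in>Z i. V $ i $ j"] sum_nonneg)
        (auto simp: birkhoff_polytope_iff)
    finally show "V \<in> birkhoff_polytope \<inter> U" using VB by (simp add: U_def)
  qed
  moreover have "convex U"
  proof -
    have "U = {Y. (\<chi> i j. of_bool (j \<in> Z i)) \<bullet> Y \<ge> 1}"
      by (simp add: U_def inner_vec_def of_bool_def if_distrib[of "\<lambda>x. x * _"] sum.If_cases
          cong: if_cong)
    then show ?thesis by (simp add: convex_halfspace_ge)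
  qed
  ultimately have "Y \<in> birkhoff_polytope \<inter> U"
    using hull_minimal[where S = convex] convex_Int[OF convex_birkhoff_polytope] Y by blast
  then have YB: "Y \<in> birkhoff_polytope" and YU: "1 \<le> (\<Sum>i\<in>UNIV. \<Sum>j\<in>Z i. Y $ i $ j)"
    by (auto simp: U_def)
  define r where "r = (\<lambda>i. card (Z i))"
  \<comment> \<open>Removing the row means leaves the inner product with \<open>Y - X\<close>
    unchanged, as the rows of \<open>Y - X\<close> sum to 0, and makes the norm as small as such row
    shifts allow.\<close>
  define C :: "real ^ 'n ^ 'n" where "C = (\<chi> i j. of_bool (j \<in> Z i) - real (r i) / ?n)"
  have "C \<bullet> (Y - X) = (\<Sum>i\<in>UNIV. \<Sum>j\<in>Z i. Y $ i $ j)"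
  proof -
    have "(\<Sum>j\<in>UNIV. C $ i $ j * (Y - X) $ i $ j) = (\<Sum>j\<in>Z i. Y $ i $ j)" for i
    proof -
      have "(\<Sum>j\<in>UNIV. C $ i $ j * (Y - X) $ i $ j)
        = (\<Sum>j\<in>UNIV. of_bool (j \<in> Z i) * (Y - X) $ i $ j) - real (r i) / ?n * (\<Sum>j\<in>UNIV. (Y - X) $ i $ j)"
        unfolding sum_distrib_left sum_subtractf[symmetric]
        by (simp add: C_def left_diff_distrib)
      also have "(\<Sum>j\<in>UNIV. (Y - X) $ i $ j) = 0"
        using XB YB by (simp add: sum_subtractf birkhoff_polytope_iff)
      also have "(\<Sum>j\<in>UNIV. of_bool (j \<in> Z i) * (Y - X) $ i $ j) = (\<Sum>j\<in>Z i. (Y - X) $ i $ j)"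
        by (simp add: of_bool_def if_distrib[of "\<lambda>x. x * _"] sum.If_cases cong: if_cong)
      also have "\<dots> = (\<Sum>j\<in>Z i. Y $ i $ j)"
        by (rule sum.cong) (use X in \<open>auto simp: Z_def\<close>)
      finally show ?thesis by simp
    qed
    then show ?thesis by (simp add: inner_vec_def)
  qed
  then have "1 \<le> C \<bullet> (Y - X)" using YU by simp
  also have "\<dots> \<le> norm C * norm (Y - X)" by (rule norm_cauchy_schwarz)
  also have "\<dots> \<le> sqrt ?m * norm (Y - X)"
  proof (rule mult_right_mono)
    have "(\<Sum>j\<in>UNIV. (C $ i $ j)\<^sup>2) \<le> ?m / ?n" for i
    proof -
      have rn: "r i \<le> CARD('n)" unfolding r_def by (rule card_mono) auto
      have "(\<Sum>j\<in>UNIV. (C $ i $ j)\<^sup>2)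
        = (\<Sum>j\<in>UNIV. of_bool (j \<in> Z i) * (1 - 2 * real (r i) / ?n) + (real (r i) / ?n)\<^sup>2)"
        by (rule sum.cong) (auto simp: C_def power2_eq_square algebra_simps)
      also have "\<dots> = real (r i) * (1 - 2 * real (r i) / ?n) + ?n * (real (r i) / ?n)\<^sup>2"
        by (simp add: sum.distrib r_def flip: sum_distrib_right)
      also have "\<dots> = real_of_int (int (r i * (CARD('n) - r i))) / ?n"
        using rn by (simp add: of_nat_diff field_simps power2_eq_square)
      also have "\<dots> \<le> ?m / ?n"
      proof (intro divide_right_mono of_int_le_iff[THEN iffD2])
        \<comment> \<open>This gives the bound by a quarter of the square; integrality of the
          product then permits the floor.\<close>
        have "0 \<le> (?n - 2 * real (r i))\<^sup>2" by simp
        then have "real (r i) * (?n - real (r i)) \<le> ?n\<^sup>2 / 4"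
          by (simp add: power2_eq_square algebra_simps)
        then show "int (r i * (CARD('n) - r i)) \<le> \<lfloor>?n\<^sup>2 / 4\<rfloor>"
          using rn by (simp add: le_floor_iff of_nat_diff)
      qed simp
      finally show ?thesis .
    qed
    then have "(\<Sum>i\<in>UNIV. \<Sum>j\<in>UNIV. (C $ i $ j)\<^sup>2) \<le> (\<Sum>i\<in>(UNIV::'n set). ?m / ?n)"
      by (rule sum_mono)
    also have "\<dots> = ?m" by simp
    finally show "norm C \<le> sqrt ?m" by (simp add: norm_matrix_eq_Frobenius)
  qed simp
  finally have le: "1 \<le> sqrt ?m * norm (Y - X)" .
  have "0 \<le> ?m" by (simp only: of_int_0_le_iff zero_le_floor) simp
  \<comment> \<open>The floor is 0 when \<open>CARD('n)\<close> is 1; \<open>le\<close> excludes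
    that case, so no division by zero occurs.\<close>
  moreover have "?m \<noteq> 0" using le by (metis mult_zero_left not_one_le_zero real_sqrt_zero)
  ultimately have "0 < sqrt ?m" by (simp only: real_sqrt_gt_0_iff order_less_le) simp
  then show ?thesis using le by (simp add: field_simps norm_minus_commute)
qed

section \<open>Cyclic permutations and the upper bound\<close>

text \<open>Transports the integers modulo \<open>CARD('n)\<close> to the index type along an
  enumeration. The last clause computes displacements in coordinates based at any
  \<open>s\<close>.\<close>

lemma ex_cyclic_offset:
  "\<exists>off :: 'n::finite \<Rightarrow> 'n \<Rightarrow> int. (\<forall>i. bij_betw (off i) UNIV {0..<int CARD('n)}) \<and>
    (\<forall>j. bij_betw (\<lambda>i. off i j) UNIV {0..<int CARD('n)}) \<and>
    (\<forall>s i j. off i j = (off s j - off s i) mod int CARD('n))"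
proof -
  let ?N = "int CARD('n)"
  obtain h :: "'n \<Rightarrow> nat" where h: "bij_betw h UNIV {0..<CARD('n)}"
    using ex_bij_betw_finite_nat[of "UNIV :: 'n set"] by auto
  define off where "off = (\<lambda>i j. (int (h j) - int (h i)) mod ?N)"
  have eq: "a = b" if "(int (h a) - int (h b)) mod ?N = 0" for a b
  proof -
    have "h a < CARD('n)" "h b < CARD('n)" using h by (auto simp: bij_betw_def)
    moreover have "int (h a) mod ?N = int (h b) mod ?N"
      using that by (simp add: mod_eq_dvd_iff mod_eq_0_iff_dvd)
    ultimately have "h a = h b" by simp
    then show ?thesis using h by (auto simp: bij_betw_def dest: injD)
  qed
  have bij: "bij_betw f UNIV {0..<?N}" if "inj f" "range f \<subseteq> {0..<?N}" for f :: "'n \<Rightarrow> int"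
    unfolding bij_betw_def using that card_subset_eq[of "{0..<?N}" "range f"]
    by (simp add: card_image)
  have rng: "off i j \<in> {0..<?N}" for i j by (simp add: off_def)
  have "inj (off i)" for i
  proof (rule injI)
    fix a b assume "off i a = off i b"
    then show "a = b" by (intro eq) (simp add: off_def mod_eq_dvd_iff mod_eq_0_iff_dvd)
  qed
  moreover have "inj (\<lambda>i. off i j)" for j
  proof (rule injI)
    fix a b assume "off a j = off b j"
    then show "a = b" by (intro eq[symmetric]) (simp add: off_def mod_eq_dvd_iff mod_eq_0_iff_dvd)
  qed
  moreover have "off i j = (off s j - off s i) mod ?N" for s i j
    by (simp add: off_def mod_diff_eq)
  ultimately show ?thesis using bij rng by (intro exI[of _ off]) blast
qed

definition permutation_matrix :: "('n \<Rightarrow> 'n) \<Rightarrow> real ^ 'n ^ 'n"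
  where "permutation_matrix p = (\<chi> i j. of_bool (j = p i))"

lemma permutation_matrix_vertex:
  fixes p :: "'n::finite \<Rightarrow> 'n"
  assumes "bij p"
  shows "permutation_matrix p \<in> vertices birkhoff_polytope"
proof (rule vertex_if_zero_one)
  have "(\<Sum>i\<in>UNIV. of_bool (j = p i) :: real) = 1" for j
  proof -
    have "(\<Sum>i\<in>UNIV. of_bool (j = p i) :: real) = (\<Sum>i\<in>UNIV. of_bool (j = i))"
      by (rule sum.reindex_bij_betw[OF assms, of "\<lambda>i. of_bool (j = i)"])
    then show ?thesis by (simp add: of_bool_def)
  qed
  then show "permutation_matrix p \<in> birkhoff_polytope"
    by (simp add: birkhoff_polytope_iff permutation_matrix_def)
qed (simp add: permutation_matrix_def)

text \<open>A positive combination of nonnegative entries vanishes only if both entries do.\<close>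

lemma zero_pattern_face_of_birkhoff_polytope:
  fixes Z :: "'n::finite \<Rightarrow> 'n \<Rightarrow> bool"
  shows "{X \<in> birkhoff_polytope. \<forall>i j. Z i j \<longrightarrow> X $ i $ j = 0} face_of birkhoff_polytope"
    (is "?F face_of _")
  unfolding face_of_def
proof (intro conjI ballI impI)
  show "convex ?F"
    using convex_birkhoff_polytope by (auto simp: convex_def)
next
  fix A B X :: "real ^ 'n ^ 'n"
  assume AB: "A \<in> birkhoff_polytope" "B \<in> birkhoff_polytope"
    and X: "X \<in> ?F" "X \<in> open_segment A B"
  obtain u where u: "0 < u" "u < 1" "X = (1 - u) *\<^sub>R A + u *\<^sub>R B"
    using X(2) by (auto simp: in_segment)
  have "A $ i $ j = 0 \<and> B $ i $ j = 0" if "Z i j" for i j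
  proof -
    have "(1 - u) * A $ i $ j + u * B $ i $ j = 0" using X(1) that u(3) by auto
    moreover have "0 \<le> A $ i $ j" "0 \<le> B $ i $ j" using AB by (auto simp: birkhoff_polytope_iff)
    ultimately show ?thesis using u by (simp add: add_nonneg_eq_0_iff)
  qed
  then show "A \<in> ?F" "B \<in> ?F" using AB by auto
qed auto

text \<open>With \<open>k = n div 2\<close>, the quarter of the square exceeds
  \<open>k * (n - k)\<close> by 0 for even \<open>n\<close> and by 1/4 for odd
  \<open>n\<close>.\<close>

lemma floor_square_div_4:
  "real_of_int \<lfloor>(real n)\<^sup>2 / 4\<rfloor> = real (n div 2) * (real n - real (n div 2))"
proof -
  have "\<lfloor>(real n)\<^sup>2 / 4\<rfloor> = int (n div 2) * (int n - int (n div 2))"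
  proof (rule floor_unique)
    have "n = 2 * (n div 2) \<or> n = 2 * (n div 2) + 1" by linarith
    then have "real n = 2 * real (n div 2) \<or> real n = 2 * real (n div 2) + 1"
      by (metis of_nat_1 of_nat_add of_nat_mult of_nat_numeral)
    then show "real_of_int (int (n div 2) * (int n - int (n div 2))) \<le> (real n)\<^sup>2 / 4"
      and "(real n)\<^sup>2 / 4 < real_of_int (int (n div 2) * (int n - int (n div 2))) + 1"
      by (auto simp: power2_eq_square algebra_simps)
  qed
  then show ?thesis by simp
qed

text \<open>The cycle of the construction in coordinates relative to its base point, so that one
  function on integers serves every base point.\<close>

definition cycle_down :: "int \<Rightarrow> int \<Rightarrow> int"
  where "cycle_down d t = (if t = 0 then d else if t \<le> d then t - 1 else t)"

lemma bij_betw_cycle_down: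
  assumes "0 \<le> d" "d < N"
  shows "bij_betw (cycle_down d) {0..<N} {0..<N}"
proof -
  have "inj_on (cycle_down d) {0..<N}"
    using assms by (auto simp: inj_on_def cycle_down_def split: if_splits)
  moreover have "cycle_down d ` {0..<N} \<subseteq> {0..<N}"
    using assms by (auto simp: cycle_down_def)
  ultimately show ?thesis
    by (simp add: bij_betw_def endo_inj_surj)
qed

lemma facial_distance_upper:
  assumes card: "CARD('n::finite) \<ge> 3"
  shows "\<exists>F \<in> proper_faces (birkhoff_polytope :: (real ^ 'n ^ 'n) set).
    setdist F (convex hull (vertices birkhoff_polytope - F))
      \<le> 1 / sqrt (real_of_int \<lfloor>(real CARD('n))\<^sup>2 / 4\<rfloor>)"
proof -
  define N where "N = int CARD('n)"
  define k where "k = int (CARD('n) div 2)"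
  define m where "m = real_of_int k * (real_of_int N - real_of_int k)"
  \<comment> \<open>The strict bound below \<open>N - 1\<close> keeps the residue of -1 out of
    \<open>{1..k}\<close>; this is where \<open>CARD('n) \<ge> 3\<close> enters.\<close>
  have k: "1 \<le> k" "k < N - 1" using card by (auto simp: N_def k_def)
  then have kr: "0 < real_of_int k" "real_of_int k < real_of_int N" "0 < real_of_int N" by linarith+
  then have m: "0 < m" by (simp add: m_def)
  obtain off :: "'n \<Rightarrow> 'n \<Rightarrow> int" where off:
    "\<And>i. bij_betw (off i) UNIV {0..<N}" "\<And>j. bij_betw (\<lambda>i. off i j) UNIV {0..<N}"
    "\<And>s i j. off i j = (off s j - off s i) mod N"
    using ex_cyclic_offset unfolding N_def by blast
  have off_self: "off i i = 0" for i using off(3)[of i i i] by simp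
  have off_inj: "off s i = off s j \<longleftrightarrow> i = j" for s i j
    using off(1)[of s] by (auto simp: bij_betw_def dest: injD)
  have off_range: "0 \<le> off i j" "off i j < N" for i j
    using off(1)[of i] by (auto simp: bij_betw_def)
  define F :: "(real ^ 'n ^ 'n) set"
    where "F = {X \<in> birkhoff_polytope. \<forall>i j. off i j \<in> {1..k} \<longrightarrow> X $ i $ j = 0}"
  define p where "p = (\<lambda>(s, d) i. inv (off s) (cycle_down d (off s i)))"
  define I where "I = (UNIV :: 'n set) \<times> {1..k}"
  have cardI: "real (card I) = real_of_int N * real_of_int k" and finI: "finite I"
    using k by (auto simp: I_def N_def)
  have p_eq: "j = p (s, d) i \<longleftrightarrow> off s j = cycle_down d (off s i)" if "d \<in> {1..k}" for s d i j
  proof -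
    have "cycle_down d (off s i) \<in> range (off s)"
      using bij_betw_cycle_down[of d N] off(1)[of s] that k off_range[of s i]
      by (auto simp: bij_betw_def)
    then have "off s (p (s, d) i) = cycle_down d (off s i)"
      by (simp add: p_def f_inv_into_f)
    then show ?thesis using off_inj by metis
  qed
  have bij_p: "bij (p x)" if "x \<in> I" for x
  proof -
    obtain s d where x: "x = (s, d)" "d \<in> {1..k}" using \<open>x \<in> I\<close> by (auto simp: I_def)
    have "inj (p x)"
    proof (rule injI)
      fix a b assume "p x a = p x b"
      then have "cycle_down d (off s a) = cycle_down d (off s b)"
        using p_eq[OF x(2)] x(1) by metis
      then have "off s a = off s b"
        using bij_betw_cycle_down[of d N] x(2) k off_range[of s]
        by (auto simp: bij_betw_def dest: inj_onD)
      then show "a = b" by (simp add: off_inj)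
    qed
    then show ?thesis by (simp add: bij_def finite_UNIV_inj_surj)
  qed
  \<comment> \<open>The displacement of \<open>p (s, d)\<close> at \<open>i\<close> is
    \<open>d\<close> if \<open>i = s\<close> and otherwise 0 or -1 modulo \<open>N\<close>. So each
    position with offset in \<open>{1..k}\<close> is met by exactly one permutation of the
    family.\<close>
  have hit: "j = p x i \<longleftrightarrow> x = (i, off i j)" if "off i j \<in> {1..k}" "x \<in> I" for i j x
  proof -
    obtain s d where x: "x = (s, d)" "d \<in> {1..k}" using \<open>x \<in> I\<close> by (auto simp: I_def)
    have "off s j = cycle_down d (off s i) \<longleftrightarrow> s = i \<and> d = off i j"
    proof
      assume eq: "off s j = cycle_down d (off s i)"
      have "off i j = (cycle_down d (off s i) - off s i) mod N"
        using off(3)[of i j s] eq by simp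
      moreover have "(- 1) mod N = N - 1"
        using k by (simp add: zmod_minus1)
      ultimately have "off s i = 0"
        using that(1) k by (auto simp: cycle_down_def split: if_splits)
      then have "s = i" using off_self off_inj by metis
      then show "s = i \<and> d = off i j" using eq by (simp add: off_self cycle_down_def)
    qed (simp add: off_self cycle_down_def)
    then show ?thesis using p_eq[OF x(2)] x(1) by auto
  qed
  have vert: "permutation_matrix (p x) \<in> vertices birkhoff_polytope - F" if "x \<in> I" for x
  proof -
    obtain s d where x: "x = (s, d)" "d \<in> {1..k}" using \<open>x \<in> I\<close> by (auto simp: I_def)
    have "off s (p x s) = d"
      using p_eq[OF x(2), of "p x s" s s] x(1) by (simp add: off_self cycle_down_def)
    then have "off s (p x s) \<in> {1..k}" using x(2) by simp
    moreover have "permutation_matrix (p x) $ s $ (p x s) \<noteq> (0 :: real)"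
      by (simp add: permutation_matrix_def)
    ultimately have "permutation_matrix (p x) \<notin> F" unfolding F_def by blast
    then show ?thesis using permutation_matrix_vertex[OF bij_p[OF that]] by simp
  qed
  define Y where "Y = (\<Sum>x\<in>I. (1 / real (card I)) *\<^sub>R permutation_matrix (p x))"
  have "I \<noteq> {}" using k by (auto simp: I_def)
  then have Y: "Y \<in> convex hull (vertices birkhoff_polytope - F)"
    unfolding Y_def using finI
    by (intro convex_sum) (auto intro!: hull_inc vert)
  have "vertices birkhoff_polytope - F \<subseteq> birkhoff_polytope"
    by (auto simp: vertices_def extreme_point_of_def)
  then have YB: "Y \<in> birkhoff_polytope"
    using Y hull_minimal[of _ birkhoff_polytope convex] convex_birkhoff_polytope by blast
  have Y_on: "Y $ i $ j = 1 / (real_of_int N * real_of_int k)" if "off i j \<in> {1..k}" for i j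
  proof -
    have "Y $ i $ j = (\<Sum>x\<in>I. 1 / real (card I) * of_bool (x = (i, off i j)))"
      unfolding Y_def sum_component
      by (rule sum.cong) (use hit[OF that] in \<open>auto simp: permutation_matrix_def\<close>)
    also have "\<dots> = 1 / real (card I)"
      using that finI by (simp add: of_bool_def if_distrib[of "\<lambda>x. _ * x"] I_def cong: if_cong)
    finally show ?thesis by (simp add: cardI)
  qed
  \<comment> \<open>The centred indicator of \<open>{1..k}\<close>. Division by \<open>m\<close>
    makes its value on \<open>{1..k}\<close> equal to \<open>1 / (N * k)\<close>, the entry of
    \<open>Y\<close> there.\<close>
  define f where "f = (\<lambda>e. (of_bool (e \<in> {1..k}) - real_of_int k / real_of_int N) / m)"
  define D :: "real ^ 'n ^ 'n" where "D = (\<chi> i j. f (off i j))"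
  have sum_f: "(\<Sum>e\<in>{0..<N}. g (of_bool (e \<in> {1..k}))) =
      real_of_int k * g 1 + (real_of_int N - real_of_int k) * g 0" for g :: "real \<Rightarrow> real"
  proof -
    have "(\<Sum>e\<in>{0..<N}. g (of_bool (e \<in> {1..k}))) =
        (\<Sum>e\<in>{0..<N}. if e \<in> {1..k} then g 1 else g 0)"
      by (rule sum.cong) auto
    also have "\<dots> = real (card ({0..<N} \<inter> {1..k})) * g 1 + real (card ({0..<N} - {1..k})) * g 0"
      by (simp add: sum.If_cases Diff_eq del: atLeastAtMost_iff)
    also have "{0..<N} \<inter> {1..k} = {1..k}" using k by auto
    also have "card ({0..<N} - {1..k}) = nat (N - k)"
      using k by (subst card_Diff_subset) auto
    finally show ?thesis using k by simp
  qed
  have sum0: "(\<Sum>e\<in>{0..<N}. f e) = 0"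
    unfolding f_def
    by (subst sum_f[of "\<lambda>b. (b - real_of_int k / real_of_int N) / m"])
      (use kr m in \<open>simp add: field_simps\<close>)
  have sum2: "(\<Sum>e\<in>{0..<N}. (f e)\<^sup>2) = 1 / (m * real_of_int N)"
  proof -
    have "(\<Sum>e\<in>{0..<N}. (f e)\<^sup>2) = real_of_int k * ((1 - real_of_int k / real_of_int N) / m)\<^sup>2
        + (real_of_int N - real_of_int k) * ((0 - real_of_int k / real_of_int N) / m)\<^sup>2"
      unfolding f_def by (rule sum_f[of "\<lambda>b. ((b - real_of_int k / real_of_int N) / m)\<^sup>2"])
    also have "\<dots> = m * real_of_int N / (real_of_int N * m)\<^sup>2"
      using kr m by (simp add: field_simps power2_eq_square) (simp add: m_def algebra_simps)
    finally show ?thesis using kr m by (simp add: power2_eq_square field_simps)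
  qed
  \<comment> \<open>Each row and each column of \<open>D\<close> runs once through all offsets, so
    its sum is that of \<open>f\<close>.\<close>
  have D_row: "(\<Sum>j\<in>UNIV. D $ i $ j) = 0" for i
    using sum.reindex_bij_betw[OF off(1)[of i], of f] sum0 by (simp add: D_def)
  have D_col: "(\<Sum>i\<in>UNIV. D $ i $ j) = 0" for j
    using sum.reindex_bij_betw[OF off(2)[of j], of f] sum0 by (simp add: D_def)
  have norm_D: "norm D = 1 / sqrt m"
  proof -
    have "(\<Sum>j\<in>UNIV. (D $ i $ j)\<^sup>2) = 1 / (m * real_of_int N)" for i
      using sum.reindex_bij_betw[OF off(1)[of i], of "\<lambda>e. (f e)\<^sup>2"] sum2 by (simp add: D_def)
    then have "norm D = sqrt (1 / m)"
      using kr by (simp add: norm_matrix_eq_Frobenius) (simp add: N_def)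
    then show ?thesis by (simp add: real_sqrt_divide)
  qed
  have X_on: "(Y - D) $ i $ j = 0" if "off i j \<in> {1..k}" for i j
    using Y_on[OF that] that kr m
    by (simp add: D_def f_def field_simps) (simp add: m_def algebra_simps)
  have "0 \<le> (Y - D) $ i $ j" for i j
  proof (cases "off i j \<in> {1..k}")
    case False
    \<comment> \<open>Outside the zero pattern, subtracting \<open>D\<close> only increases the
      entries of \<open>Y\<close>.\<close>
    then have "D $ i $ j \<le> 0" using kr m by (auto simp: D_def f_def)
    moreover have "0 \<le> Y $ i $ j" using YB by (simp add: birkhoff_polytope_iff)
    ultimately show ?thesis by simp
  qed (simp add: X_on del: vector_minus_component)
  then have XF: "Y - D \<in> F"
    using YB D_row D_col X_on by (simp add: F_def birkhoff_polytope_iff sum_subtractf)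
  obtain x where "x \<in> I" using \<open>I \<noteq> {}\<close> by auto
  then have "F \<noteq> birkhoff_polytope"
    using vert[of x] by (auto simp: vertices_def extreme_point_of_def)
  then have "F \<in> proper_faces birkhoff_polytope"
    using XF zero_pattern_face_of_birkhoff_polytope[of "\<lambda>i j. off i j \<in> {1..k}"]
    by (auto simp: proper_faces_def F_def)
  moreover have "setdist F (convex hull (vertices birkhoff_polytope - F)) \<le> 1 / sqrt m"
    using setdist_le_dist[OF XF Y] norm_D by (simp add: dist_norm)
  moreover have "m = real_of_int \<lfloor>(real CARD('n))\<^sup>2 / 4\<rfloor>"
    by (simp add: floor_square_div_4 m_def N_def k_def)
  ultimately show ?thesis by auto
qed

theorem proposition3p1:
  assumes "CARD('n::finite) \<ge> 3"
  shows "facial_distance (birkhoff_polytope :: (real ^ 'n ^ 'n) set) =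
    1 / sqrt (real_of_int \<lfloor>(real CARD('n))\<^sup>2 / 4\<rfloor>)"
proof -
  let ?B = "birkhoff_polytope :: (real ^ 'n ^ 'n) set"
  let ?d = "\<lambda>F. setdist F (convex hull (vertices ?B - F))"
  obtain F where F: "F \<in> proper_faces ?B"
    "?d F \<le> 1 / sqrt (real_of_int \<lfloor>(real CARD('n))\<^sup>2 / 4\<rfloor>)"
    using facial_distance_upper[OF assms] by blast
  \<comment> \<open>Attainment of the distance turns the bound for pairs into one for
    \<open>setdist\<close>.\<close>
  have lower: "1 / sqrt (real_of_int \<lfloor>(real CARD('n))\<^sup>2 / 4\<rfloor>) \<le> ?d G" if "G \<in> proper_faces ?B" for G
    using proper_face_setdist_attained(5)[OF polytope_birkhoff_polytope that]
      facial_distance_lower[OF that] by metis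
  have "Min (?d ` proper_faces ?B) = ?d F"
  proof (rule Min_eqI)
    show "finite (?d ` proper_faces ?B)"
      using finite_proper_faces[OF polytope_birkhoff_polytope] by blast
  qed (use F lower in \<open>force+\<close>)
  then show ?thesis
    using F lower[OF F(1)] by (simp add: facial_distance_def)
qed

end
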